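(* Let $t_n=(-1)^{s_2(n)}$, $h_0=0$, $h_1=1$, and $h_n=t_nh_{n-1}+h_{n-2}$ for $n\ge2$. The power series $H(x)=\sum_{n=0}^{\infty}h_nx^n$ is transcendental over $\mathbb{Q}(x)$.
   Context: $s_2(n)$ denotes the number of 1's in the binary expansion of $n$; $(t_n)$ is the Prouhet–Thue–Morse sequence. *)

theory Defs
  imports
    "HOL-Computational_Algebra.Computational_Algebra"
    "HOL-Algebra.Algebraic_Closure_Type"
begin

definition binary_ones :: "nat \<Rightarrow> nat" where
  "binary_ones n = card {k. bit n k}"

definition thue_morse :: "nat \<Rightarrow> int" where
  "thue_morse n = (-1) ^ binary_ones n"

fun hseq :: "nat \<Rightarrow> int" where
  "hseq 0 = 0"
| "hseq (Suc 0) = 1"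
| "hseq (Suc (Suc n)) = thue_morse (Suc (Suc n)) * hseq (Suc n) + hseq n"

definition Hseries :: "rat fps" where
  "Hseries = Abs_fps (\<lambda>n. of_int (hseq n))"

text \<open>
  The field \<open>K(x)\<close> of rational functions, realised as a subfield of the field \<open>K((x))\<close> of formal
  Laurent series, which also contains \<open>K[[x]]\<close>.
\<close>

definition rational_functions :: "'a :: field fls set" where
  "rational_functions =
     {fps_to_fls (fps_of_poly p) / fps_to_fls (fps_of_poly q) | p q. q \<noteq> 0}"

lemma finite_bits_nat: "finite {k. bit (n :: nat) k}"
proof (rule finite_subset)
  show "{k. bit n k} \<subseteq> {..<n}"
  proof
    fix k assume "k \<in> {k. bit n k}"
    then have "n div 2 ^ k \<noteq> 0" by (metis bit_iff_odd even_zero mem_Collect_eq)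
    then have "(2 :: nat) ^ k \<le> n" by (meson div_less not_le)
    moreover have "k < (2 :: nat) ^ k" by (rule less_exp)
    ultimately show "k \<in> {..<n}" by (metis less_le_trans lessThan_iff)
  qed
qed simp

lemma ring_of_type_simps:
  "carrier (ring_of_type_algebra :: 'a :: field ring) = UNIV"
  "\<zero>\<^bsub>ring_of_type_algebra\<^esub> = (0 :: 'a)"
  "\<one>\<^bsub>ring_of_type_algebra\<^esub> = (1 :: 'a)"
  "(x :: 'a) \<oplus>\<^bsub>ring_of_type_algebra\<^esub> y = x + y"
  "(x :: 'a) \<otimes>\<^bsub>ring_of_type_algebra\<^esub> y = x * y"
  by (simp_all add: ring_of_type_algebra_def)

lemma ring_of_type_a_inv: "\<ominus>\<^bsub>ring_of_type_algebra\<^esub> (x :: 'a :: field) = - x"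
proof -
  interpret R: Ring.field "ring_of_type_algebra :: 'a ring"
    by (rule field_from_type_algebra)
  show ?thesis
    by (rule R.minus_equality) (simp_all add: ring_of_type_simps)
qed

lemma ring_of_type_pow: "(x :: 'a :: field) [^]\<^bsub>ring_of_type_algebra\<^esub> (n :: nat) = x ^ n"
  by (induction n) (simp_all add: ring_of_type_simps nat_pow_def mult.commute)

lemma ring_of_type_m_inv:
  assumes "(x :: 'a :: field) \<noteq> 0"
  shows "inv\<^bsub>ring_of_type_algebra\<^esub> x = inverse x"
proof -
  interpret R: Ring.field "ring_of_type_algebra :: 'a ring"
    by (rule field_from_type_algebra)
  show ?thesis
    using assms by (intro R.comm_inv_char) (simp_all add: ring_of_type_simps)
qed

lemma ring_of_type_eval:
  "ring.eval (ring_of_type_algebra :: 'a :: field ring) ps x = poly (Poly (rev ps)) x"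
proof -
  interpret R: Ring.field "ring_of_type_algebra :: 'a ring"
    by (rule field_from_type_algebra)
  show ?thesis
    by (induction ps)
       (simp_all add: ring_of_type_simps ring_of_type_pow Poly_snoc poly_monom add.commute)
qed

lemma rational_functionsI:
  "q \<noteq> 0 \<Longrightarrow> fps_to_fls (fps_of_poly p) / fps_to_fls (fps_of_poly q) \<in> rational_functions"
  unfolding rational_functions_def by blast

lemma subfield_rational_functions:
  "subfield (rational_functions :: 'a :: field fls set) ring_of_type_algebra"
proof -
  interpret R: Ring.field "ring_of_type_algebra :: 'a fls ring"
    by (rule field_from_type_algebra)
  let ?K = "rational_functions :: 'a fls set"
  let ?e = "\<lambda>p :: 'a poly. fps_to_fls (fps_of_poly p)"
  have e_add: "?e (p + q) = ?e p + ?e q" for p q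
    by (simp add: fps_of_poly_add)
  have e_mult: "?e (p * q) = ?e p * ?e q" for p q
    by (simp add: fps_of_poly_mult fls_times_fps_to_fls)
  have e_uminus: "?e (- p) = - ?e p" for p
    by (simp add: fps_of_poly_uminus)
  have e_0: "?e p = 0 \<longleftrightarrow> p = 0" for p
    by simp
  have "subring ?K ring_of_type_algebra"
  proof (rule R.subringI)
    show "\<one>\<^bsub>ring_of_type_algebra\<^esub> \<in> ?K"
      using rational_functionsI[of 1 1] by (simp add: ring_of_type_simps)
    fix f assume "f \<in> ?K"
    then obtain p q where f: "f = ?e p / ?e q" "q \<noteq> 0"
      unfolding rational_functions_def by blast
    then have "- f = ?e (- p) / ?e q"
      by (simp only: e_uminus minus_divide_left)
    then show "\<ominus>\<^bsub>ring_of_type_algebra\<^esub> f \<in> ?K"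
      using rational_functionsI[OF f(2)] by (simp only: ring_of_type_a_inv)
    fix g assume "g \<in> ?K"
    then obtain r s where g: "g = ?e r / ?e s" "s \<noteq> 0"
      unfolding rational_functions_def by blast
    have qs: "q * s \<noteq> 0" using f g by simp
    have "f * g = ?e (p * r) / ?e (q * s)"
      unfolding f g e_mult by (rule times_divide_times_eq)
    then show "f \<otimes>\<^bsub>ring_of_type_algebra\<^esub> g \<in> ?K"
      using rational_functionsI[OF qs] by (simp only: ring_of_type_simps)
    have "f + g = ?e (p * s + r * q) / ?e (q * s)"
      unfolding f(1) g(1) e_mult e_add using f(2) g(2) e_0 by (intro add_frac_eq) simp_all
    then show "f \<oplus>\<^bsub>ring_of_type_algebra\<^esub> g \<in> ?K"
      using rational_functionsI[OF qs] by (simp only: ring_of_type_simps)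
  qed (simp add: ring_of_type_simps)
  then show ?thesis
  proof (rule R.subfieldI')
    fix f assume "f \<in> ?K - {\<zero>\<^bsub>ring_of_type_algebra\<^esub>}"
    then obtain p q where f: "f = ?e p / ?e q" "q \<noteq> 0" and nz: "f \<noteq> 0"
      unfolding rational_functions_def by (auto simp: ring_of_type_simps)
    have p: "p \<noteq> 0" using f nz by auto
    have "inverse f = ?e q / ?e p" using f by simp
    then show "inv\<^bsub>ring_of_type_algebra\<^esub> f \<in> ?K"
      using rational_functionsI[OF p] by (simp only: ring_of_type_m_inv[OF nz])
  qed
qed

text \<open>
  On the ring structure of a field type, transcendence in the sense of \<open>HOL-Algebra\<close> agrees with
  the usual condition in terms of the type \<open>'a poly\<close>.
\<close>

lemma transcendental_type_iff:
  fixes K :: "'a :: field set"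
  assumes "subring K ring_of_type_algebra"
  shows "ring.transcendental ring_of_type_algebra K x \<longleftrightarrow>
           (\<forall>p. (\<forall>i. poly.coeff p i \<in> K) \<and> poly p x = 0 \<longrightarrow> p = 0)"
proof -
  interpret R: Ring.field "ring_of_type_algebra :: 'a ring"
    by (rule field_from_type_algebra)
  have zero: "0 \<in> K"
    using subringE(2)[OF assms] by (simp add: ring_of_type_simps)
  show ?thesis
  proof (intro iffI allI impI)
    fix p assume tr: "R.transcendental K x"
      and p: "(\<forall>i. poly.coeff p i \<in> K) \<and> poly p x = 0"
    show "p = 0"
    proof (rule ccontr)
      assume nz: "p \<noteq> 0"
      let ?ps = "rev (coeffs p)"
      have "set ?ps \<subseteq> K" using p by (auto simp: coeffs_def)
      moreover have "hd ?ps \<noteq> 0"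
        using nz by (simp add: hd_rev last_coeffs_eq_coeff_degree)
      ultimately have "?ps \<in> carrier (K [X]\<^bsub>ring_of_type_algebra\<^esub>)"
        by (simp add: univ_poly_def polynomial_def ring_of_type_simps)
      moreover have "R.eval ?ps x = \<zero>\<^bsub>ring_of_type_algebra\<^esub>"
        using p by (simp add: ring_of_type_eval ring_of_type_simps)
      ultimately have "?ps = []"
        using R.eval_transcendental[of K x ?ps] tr by (simp add: over_def)
      then show False using nz by simp
    qed
  next
    assume *: "\<forall>p. (\<forall>i. poly.coeff p i \<in> K) \<and> poly p x = 0 \<longrightarrow> p = 0"
    show "R.transcendental K x"
    proof (rule ccontr)
      assume "\<not> R.transcendental K x"
      then obtain ps where ps: "ps \<in> carrier (K [X]\<^bsub>ring_of_type_algebra\<^esub>)" "ps \<noteq> []"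
          "R.eval ps x = \<zero>\<^bsub>ring_of_type_algebra\<^esub>"
        using R.algebraicE[OF assms, of x] by (auto simp: over_def ring_of_type_simps)
      have set: "set ps \<subseteq> K" and hd: "hd ps \<noteq> 0"
        using ps(1,2) by (auto simp: univ_poly_def polynomial_def ring_of_type_simps)
      have "poly.coeff (Poly (rev ps)) i \<in> K" for i
        using set zero nth_mem[of i "rev ps"] by (auto simp: nth_default_def)
      moreover have "poly (Poly (rev ps)) x = 0"
        using ps(3) by (simp add: ring_of_type_eval ring_of_type_simps)
      ultimately have "Poly (rev ps) = 0" using * by blast
      then obtain n where "rev ps = replicate n 0" by (auto simp: Poly_eq_0)
      then have "\<forall>y\<in>set ps. y = 0" by (metis in_set_replicate set_rev)
      then show False using hd ps(2) by simp
    qed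
  qed
qed

end

theory Submission
  imports Defs
begin

text \<open>
  If \<open>H\<close> is algebraic over \<open>K = \<rat>(x)\<close>, the finite extension \<open>K(H)\<close> is closed under the Euler
  derivation \<open>x d/dx\<close>, so the iterated derivatives of \<open>H\<close> are linearly dependent over \<open>K\<close>; comparing
  coefficients, \<open>h\<close> satisfies a recurrence \<open>\<Sum>j\<le>J. p\<^sub>j(n) h\<^sub>n\<^sub>+\<^sub>j = 0\<close> with polynomials \<open>p\<^sub>j\<close> and
  \<open>p\<^sub>J \<noteq> 0\<close>. At the occurrences of a fixed factor \<open>w\<close> of length \<open>J + 1\<close> of the Thue-Morse word,
  \<open>h\<^sub>n\<^sub>+\<^sub>j\<close> is a fixed combination of \<open>h\<^sub>n\<close> and \<open>h\<^sub>n\<^sub>+\<^sub>1\<close>, and the recurrence turns into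
  \<open>a\<^sub>w(n) h\<^sub>n + b\<^sub>w(n) h\<^sub>n\<^sub>+\<^sub>1 = 0\<close>. Two factors that differ only in their last letter cannot both give
  the trivial relation, so some \<open>w\<close> gives a nontrivial one. Since \<open>h\<^sub>n\<close> and \<open>h\<^sub>n\<^sub>+\<^sub>1\<close> are
  coprime integers, both are then bounded by a polynomial in \<open>n\<close> at the occurrences of \<open>w\<close>, and these have
  bounded gaps, so \<open>h\<close> is polynomially bounded.

  On the other hand the transfer matrices of the Thue-Morse blocks of length \<open>2\<^sup>k\<close> have determinant 1
  and traces satisfying \<open>x\<^sub>k\<^sub>+\<^sub>2 = x\<^sub>k\<^sup>2 (x\<^sub>k\<^sub>+\<^sub>1 - 2) + 2\<close>, which grow doubly
  exponentially. The positions from \<open>2\<^sup>k\<close> to \<open>3 \<cdot> 2\<^sup>k\<close> carry the same block twice, and there the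
  Cayley-Hamilton theorem bounds \<open>x\<^sub>k\<close> by values of \<open>h\<close>.
\<close>

section \<open>Algebraic elements satisfy linear differential equations\<close>

text \<open>Applying \<open>D\<close> to a relation p(x) = 0 over \<open>K\<close> gives q(x) +
  p'(x) D x = 0, where q arises from p by applying \<open>D\<close> to the coefficients. For p of
  least degree p'(x) is nonzero, so D x lies in K(x).\<close>

lemma derivation_closed_simple_extension:
  fixes K :: "'a :: field_char_0 set" and D :: "'a \<Rightarrow> 'a"
  assumes K: "subfield K ring_of_type_algebra"
    and add: "\<And>x y. D (x + y) = D x + D y"
    and mult: "\<And>x y. D (x * y) = D x * y + x * D y"
    and DK: "\<And>k. k \<in> K \<Longrightarrow> D k \<in> K"
    and alg: "\<not> ring.transcendental ring_of_type_algebra K x"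
    and u: "u \<in> ring.simple_extension ring_of_type_algebra K x"
  shows "D u \<in> ring.simple_extension ring_of_type_algebra K x"
proof -
  interpret R: Ring.field "ring_of_type_algebra :: 'a ring"
    by (rule field_from_type_algebra)
  let ?E = "R.simple_extension K x"
  have Ksub: "subring K ring_of_type_algebra"
    using K subfieldE(1) by blast
  have KE: "K \<subseteq> ?E"
    by (rule R.simple_extension_incl) (simp_all add: ring_of_type_simps)
  have xE: "x \<in> ?E"
    by (rule R.simple_extension_mem[OF Ksub]) (simp add: ring_of_type_simps)
  have E: "subfield ?E ring_of_type_algebra"
    using R.simple_extension_is_subfield[OF K, of x] alg by (simp add: over_def ring_of_type_simps)
  note Esub = subfieldE(1)[OF E]
  have Eadd: "a + b \<in> ?E" and Emult: "a * b \<in> ?E" if "a \<in> ?E" "b \<in> ?E" for a b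
    using subringE(6,7)[OF Esub that] by (simp_all add: ring_of_type_simps)
  have Euminus: "- a \<in> ?E" if "a \<in> ?E" for a
    using subringE(5)[OF Esub that] by (simp add: ring_of_type_a_inv)
  have E0: "0 \<in> ?E" and K0: "0 \<in> K" and K1: "1 \<in> K"
    using subringE(2)[OF Esub] subringE(2,3)[OF Ksub] by (simp_all add: ring_of_type_simps)
  have Kadd: "a + b \<in> K" and Kmult: "a * b \<in> K" if "a \<in> K" "b \<in> K" for a b
    using subringE(6,7)[OF Ksub that] by (simp_all add: ring_of_type_simps)
  have Kof_nat: "of_nat n \<in> K" for n
    by (induction n) (auto intro: K0 K1 Kadd)
  have Einverse: "inverse a \<in> ?E" if "a \<in> ?E" for a
  proof (cases "a = 0")
    case False
    then show ?thesis
      using R.subfield_m_inv(1)[OF E, of a] that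
      by (simp add: ring_of_type_m_inv ring_of_type_simps)
  qed (simp add: E0)
  have D0: "D 0 = 0"
    using add[of 0 0] by simp
  have Epoly: "poly p x \<in> ?E" if "\<And>i. poly.coeff p i \<in> K" for p
    using that
  proof (induction p)
    case 0
    then show ?case by (simp add: E0)
  next
    case (pCons a p)
    have "poly.coeff p i \<in> K" for i
      using pCons.prems[of "Suc i"] by simp
    moreover have "a \<in> K" using pCons.prems[of 0] by simp
    ultimately show ?case
      using pCons.IH KE xE by (auto intro!: Eadd Emult)
  qed
  have Dpoly: "D (poly p x) = poly (map_poly D p) x + poly (pderiv p) x * D x" for p
    by (induction p) (simp_all add: D0 map_poly_pCons add mult pderiv_pCons algebra_simps)
  define P where "P = (\<lambda>p. (\<forall>i. poly.coeff p i \<in> K) \<and> poly p x = 0 \<and> p \<noteq> 0)"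
  have "\<exists>p. P p"
    using alg unfolding transcendental_type_iff[OF Ksub] P_def by blast
  then obtain p where p: "P p" and min: "\<And>q. P q \<Longrightarrow> Polynomial.degree p \<le> Polynomial.degree q"
    using ex_has_least_nat[of P _ Polynomial.degree] by blast
  have cder: "poly.coeff (pderiv p) i \<in> K" for i
    using p Kmult[OF Kof_nat[of "Suc i"], of "poly.coeff p (Suc i)"]
    by (simp add: coeff_pderiv P_def)
  \<comment> \<open>In characteristic 0 the derivative of a nonconstant polynomial is nonzero, so
    p'(x) = 0 would contradict minimality.\<close>
  have nz: "poly (pderiv p) x \<noteq> 0"
  proof
    assume z: "poly (pderiv p) x = 0"
    have deg: "Polynomial.degree p > 0"
    proof (rule ccontr)
      assume "\<not> ?thesis"
      then obtain a where "p = [:a:]" by (metis degree_eq_zeroE gr0I)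
      with p show False by (auto simp: P_def)
    qed
    then have "pderiv p \<noteq> 0" by (simp add: pderiv_eq_0_iff)
    with z cder have "P (pderiv p)" by (simp add: P_def)
    from min[OF this] deg show False by (simp add: degree_pderiv)
  qed
  have "poly (map_poly D p) x + poly (pderiv p) x * D x = 0"
    using Dpoly[of p] p by (simp add: P_def D0)
  then have "D x = - poly (map_poly D p) x * inverse (poly (pderiv p) x)"
    using nz by (simp add: field_simps eq_neg_iff_add_eq_0)
  moreover have "poly (map_poly D p) x \<in> ?E"
    by (rule Epoly) (use p in \<open>auto simp: coeff_map_poly D0 P_def intro: DK\<close>)
  ultimately have Dx: "D x \<in> ?E"
    using Epoly[OF cder] by (auto intro!: Emult Euminus Einverse)
  \<comment> \<open>The simple extension is generated by Horner steps k1 x + k2 with k2 in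
    \<open>K\<close>.\<close>
  show ?thesis using u
  proof (induction rule: R.simple_extension.induct)
    case zero
    then show ?case using E0 by (simp add: ring_of_type_simps D0)
  next
    case (lin k1 k2)
    then show ?case using KE DK Dx xE
      by (auto simp: ring_of_type_simps add mult intro!: Eadd Emult)
  qed
qed

lemma combine_type_sum:
  fixes Ks Us :: "'a :: field list"
  assumes "length Ks = length Us"
  shows "ring.combine ring_of_type_algebra Ks Us = (\<Sum>i<length Us. Ks ! i * Us ! i)"
proof -
  interpret R: Ring.field "ring_of_type_algebra :: 'a ring"
    by (rule field_from_type_algebra)
  show ?thesis using assms
    by (induction rule: list_induct2)
       (simp_all add: ring_of_type_simps sum.lessThan_Suc_shift del: sum.lessThan_Suc)
qed

text \<open>K(x) has some finite dimension n over \<open>K\<close> and contains all iterated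
  derivatives of x, so x and its first n derivatives are linearly dependent.\<close>

theorem algebraic_imp_linear_ode:
  fixes K :: "'a :: field_char_0 set" and D :: "'a \<Rightarrow> 'a"
  assumes K: "subfield K ring_of_type_algebra"
    and add: "\<And>x y. D (x + y) = D x + D y"
    and mult: "\<And>x y. D (x * y) = D x * y + x * D y"
    and DK: "\<And>k. k \<in> K \<Longrightarrow> D k \<in> K"
    and alg: "\<not> ring.transcendental ring_of_type_algebra K x"
  obtains n c where "\<And>i. i \<le> n \<Longrightarrow> c i \<in> K" "\<exists>i\<le>n. c i \<noteq> 0"
    "(\<Sum>i\<le>n. c i * (D ^^ i) x) = 0"
proof -
  interpret R: Ring.field "ring_of_type_algebra :: 'a ring"
    by (rule field_from_type_algebra)
  let ?E = "R.simple_extension K x"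
  have Ksub: "subring K ring_of_type_algebra"
    using K subfieldE(1) by blast
  have DE: "(D ^^ i) x \<in> ?E" for i
  proof (induction i)
    case 0
    show ?case
      using R.simple_extension_mem[OF Ksub, of x] by (simp add: ring_of_type_simps)
  next
    case (Suc i)
    then show ?case
      using derivation_closed_simple_extension[OF K add mult DK alg] by simp
  qed
  obtain n where n: "R.dimension n K ?E"
    using R.dimension_simple_extension[OF K, of x] alg by (auto simp: over_def ring_of_type_simps)
  let ?Us = "map (\<lambda>i. (D ^^ i) x) [0..<Suc n]"
  have "R.dependent K ?Us"
    using R.independent_length_le_dimension[OF K n, of ?Us] DE by auto
  then obtain Ks where Ks: "length Ks = length ?Us" "R.combine Ks ?Us = 0"
      "set Ks \<subseteq> K" "set Ks \<noteq> {0}"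
    using R.dependent_imp_non_trivial_combine[OF K, of ?Us]
    by (auto simp: ring_of_type_simps)
  show ?thesis
  proof (rule that[of n "\<lambda>i. Ks ! i"])
    show "Ks ! i \<in> K" if "i \<le> n" for i
      using Ks that by (metis diff_zero le_imp_less_Suc length_map length_upt nth_mem subset_eq)
    have "(\<Sum>i<Suc n. Ks ! i * ?Us ! i) = 0"
      using Ks by (simp add: combine_type_sum del: upt_Suc)
    then have "(\<Sum>i<Suc n. Ks ! i * (D ^^ i) x) = 0"
      by (simp del: upt_Suc sum.lessThan_Suc)
    then show "(\<Sum>i\<le>n. Ks ! i * (D ^^ i) x) = 0"
      by (simp only: lessThan_Suc_atMost)
    show "\<exists>i\<le>n. Ks ! i \<noteq> 0"
    proof (rule ccontr)
      assume "\<not> ?thesis"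
      then have "\<forall>y\<in>set Ks. y = 0" using Ks(1) by (auto simp: in_set_conv_nth)
      moreover have "Ks \<noteq> []" using Ks(1) by auto
      ultimately have "set Ks = {0}" by (metis insertCI insert_absorb last_in_set subsetI subset_singletonD)
      with Ks(4) show False by simp
    qed
  qed
qed

section \<open>Algebraic power series have P-recursive coefficients\<close>

instance fls :: (field_char_0) field_char_0 ..

text \<open>Unlike d/dx, the Euler derivation does not shift indices: it multiplies the n-th
  coefficient by n, so its i-th iterate produces the factor n^i.\<close>

definition fls_theta :: "'a :: field_char_0 fls \<Rightarrow> 'a fls" where
  "fls_theta f = fls_X * fls_deriv f"

lemma fls_theta_add: "fls_theta (f + g) = fls_theta f + fls_theta g"
  by (simp add: fls_theta_def algebra_simps)

lemma fls_theta_mult: "fls_theta (f * g) = fls_theta f * g + f * fls_theta g"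
  by (simp add: fls_theta_def algebra_simps)

lemma fls_theta_fps_to_fls: "fls_theta (fps_to_fls f) = fps_to_fls (fps_X * fps_deriv f)"
  by (simp add: fls_theta_def fls_deriv_fps_to_fls fls_times_fps_to_fls fls_X_times_conv_shift)

lemma fls_theta_power_fps_to_fls:
  "(fls_theta ^^ i) (fps_to_fls (Abs_fps h)) = fps_to_fls (Abs_fps (\<lambda>n. of_nat n ^ i * h n))"
proof (induction i)
  case (Suc i)
  have "fps_X * fps_deriv (Abs_fps (\<lambda>n. of_nat n ^ i * h n)) = Abs_fps (\<lambda>n. of_nat n ^ Suc i * h n)"
    by (rule fps_ext) (simp add: algebra_simps)
  with Suc show ?case
    by (simp add: fls_theta_fps_to_fls)
qed simp

lemma fls_theta_rational_functions:
  assumes "f \<in> rational_functions"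
  shows "fls_theta f \<in> rational_functions"
proof -
  let ?e = "\<lambda>p :: 'a poly. fps_to_fls (fps_of_poly p)"
  from assms obtain p q where f: "f = ?e p / ?e q" and q: "q \<noteq> 0"
    unfolding rational_functions_def by blast
  have theta: "fls_theta (?e r) = ?e (pCons 0 (pderiv r))" for r
    by (simp add: fls_theta_fps_to_fls fps_of_poly_pderiv fps_of_poly_pCons)
  have mult: "?e (r * s) = ?e r * ?e s" and diff: "?e (r - s) = ?e r - ?e s" for r s
    by (simp_all add: fps_of_poly_mult fps_of_poly_diff fls_times_fps_to_fls)
  have eq: "?e q \<noteq> 0" using q by simp
  \<comment> \<open>The product rule for p = f q takes the place of a quotient rule.\<close>
  then have "?e p = f * ?e q" by (simp add: f)
  then have "fls_theta (?e p) = fls_theta f * ?e q + f * fls_theta (?e q)"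
    by (simp only: fls_theta_mult)
  then have "fls_theta f = ?e (pCons 0 (pderiv p) * q - p * pCons 0 (pderiv q)) / ?e (q * q)"
    unfolding theta mult diff f using eq by (simp add: field_simps del: fps_to_fls_eq_0_iff)
  then show ?thesis
    using rational_functionsI[of "q * q"] q by (simp del: fps_of_poly_mult)
qed

lemma rational_functions_common_denominator:
  fixes c :: "nat \<Rightarrow> 'a :: field fls"
  assumes "\<And>i. i \<le> n \<Longrightarrow> c i \<in> rational_functions"
  obtains b q where "b \<noteq> 0"
    "\<And>i. i \<le> n \<Longrightarrow> c i * fps_to_fls (fps_of_poly b) = fps_to_fls (fps_of_poly (q i))"
proof -
  let ?e = "\<lambda>p :: 'a poly. fps_to_fls (fps_of_poly p)"
  have "\<forall>i\<in>{..n}. \<exists>p r. r \<noteq> 0 \<and> c i = ?e p / ?e r"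
    using assms unfolding rational_functions_def by blast
  then obtain p r where pr: "\<And>i. i \<le> n \<Longrightarrow> r i \<noteq> 0" "\<And>i. i \<le> n \<Longrightarrow> c i = ?e (p i) / ?e (r i)"
    by (metis atMost_iff)
  have mult: "?e (s * t) = ?e s * ?e t" for s t
    by (simp add: fps_of_poly_mult fls_times_fps_to_fls)
  show ?thesis
  proof (rule that[of "\<Prod>j\<le>n. r j" "\<lambda>i. p i * (\<Prod>j\<in>{..n}-{i}. r j)"])
    show "(\<Prod>j\<le>n. r j) \<noteq> 0" using pr by simp
    fix i assume i: "i \<le> n"
    then have "(\<Prod>j\<le>n. r j) = r i * (\<Prod>j\<in>{..n}-{i}. r j)"
      by (subst prod.remove[of _ i]) auto
    moreover have "?e (r i) \<noteq> 0" using pr(1)[OF i] by simp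
    ultimately show "c i * ?e (\<Prod>j\<le>n. r j) = ?e (p i * (\<Prod>j\<in>{..n}-{i}. r j))"
      unfolding pr(2)[OF i] by (simp only: mult) simp
  qed
qed

text \<open>With denominators cleared, the coefficient of x^N in the differential equation is the
  sum of Q_m(N - m) h_(N-m), where Q_m collects the coefficients of x^m in the q_i. The parameter
  \<open>r\<close> lets the order be prescribed from below.\<close>

theorem algebraic_imp_P_recursive:
  fixes h :: "nat \<Rightarrow> 'a :: field_char_0"
  assumes alg: "\<not> ring.transcendental ring_of_type_algebra rational_functions
                    (fps_to_fls (Abs_fps h))"
  obtains J p where "J \<ge> r" "p J \<noteq> 0"
    "\<And>n. (\<Sum>j\<le>J. poly (p j) (of_nat n) * h (n + j)) = 0"
proof -
  let ?e = "\<lambda>p :: 'a poly. fps_to_fls (fps_of_poly p)"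
  let ?H = "\<lambda>i. Abs_fps (\<lambda>n. of_nat n ^ i * h n)"
  obtain d c where c: "\<And>i. i \<le> d \<Longrightarrow> c i \<in> rational_functions" "\<exists>i\<le>d. c i \<noteq> 0"
      and "(\<Sum>i\<le>d. c i * (fls_theta ^^ i) (fps_to_fls (Abs_fps h))) = 0"
    using algebraic_imp_linear_ode[OF subfield_rational_functions fls_theta_add fls_theta_mult
        fls_theta_rational_functions alg] by blast
  then have ode: "(\<Sum>i\<le>d. c i * fps_to_fls (?H i)) = 0"
    by (simp add: fls_theta_power_fps_to_fls)
  obtain b q where b: "b \<noteq> 0" and q: "\<And>i. i \<le> d \<Longrightarrow> c i * ?e b = ?e (q i)"
    using rational_functions_common_denominator[of d c, OF c(1)] by metis
  have "fps_to_fls (\<Sum>i\<le>d. fps_of_poly (q i) * ?H i) = (\<Sum>i\<le>d. ?e (q i) * fps_to_fls (?H i))"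
    by (induction d) (simp_all add: fls_times_fps_to_fls)
  also have "\<dots> = (\<Sum>i\<le>d. c i * fps_to_fls (?H i)) * ?e b"
    unfolding sum_distrib_right by (rule sum.cong) (simp_all add: q[symmetric] mult_ac)
  finally have ode': "(\<Sum>i\<le>d. fps_of_poly (q i) * ?H i) = 0"
    using ode by simp
  define Q where "Q m = (\<Sum>i\<le>d. monom (poly.coeff (q i) m) i)" for m
  have coeffQ: "poly.coeff (Q m) i = (if i \<le> d then poly.coeff (q i) m else 0)" for m i
    by (simp add: Q_def coeff_sum)
  have rec: "(\<Sum>m\<le>N. poly (Q m) (of_nat (N - m)) * h (N - m)) = 0" for N
  proof -
    have "0 = (\<Sum>i\<le>d. fps_of_poly (q i) * ?H i) $ N"
      by (simp add: ode')
    also have "\<dots> = (\<Sum>i\<le>d. \<Sum>m\<le>N. poly.coeff (q i) m * (of_nat (N - m) ^ i * h (N - m)))"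
      by (simp add: fps_sum_nth fps_mult_nth atLeast0AtMost)
    also have "\<dots> = (\<Sum>m\<le>N. \<Sum>i\<le>d. poly.coeff (q i) m * (of_nat (N - m) ^ i * h (N - m)))"
      by (rule sum.swap)
    also have "\<dots> = (\<Sum>m\<le>N. poly (Q m) (of_nat (N - m)) * h (N - m))"
      by (simp add: Q_def poly_sum poly_monom sum_distrib_right mult.assoc)
    finally show ?thesis by simp
  qed
  obtain i where i: "i \<le> d" "c i \<noteq> 0" using c by blast
  then have "q i \<noteq> 0" using q[OF i(1)] b by auto
  then obtain m1 where "poly.coeff (q i) m1 \<noteq> 0" by (auto simp: poly_eq_iff)
  then have "Q m1 \<noteq> 0" using coeffQ[of m1 i] i by auto
  \<comment> \<open>The least m with Q_m nonzero belongs to the largest index of h, hence to the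
    leading coefficient.\<close>
  define m0 where "m0 = (LEAST m. Q m \<noteq> 0)"
  have below: "Q m = 0" if "m < m0" for m
    using that unfolding m0_def by (blast dest: not_less_Least)
  have m0: "Q m0 \<noteq> 0" unfolding m0_def using \<open>Q m1 \<noteq> 0\<close> by (rule LeastI)
  define M where "M = (\<Sum>i\<le>d. Polynomial.degree (q i))"
  have above: "Q m = 0" if "m > M" for m
  proof -
    have "poly.coeff (q i) m = 0" if "i \<le> d" for i
    proof (rule coeff_eq_0)
      have "Polynomial.degree (q i) \<le> M"
        unfolding M_def by (rule member_le_sum) (use that in auto)
      with \<open>m > M\<close> show "Polynomial.degree (q i) < m" by simp
    qed
    then show ?thesis by (simp add: Q_def)
  qed
  have "m0 \<le> M" using m0 above[of m0] by (meson not_le)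
  \<comment> \<open>Q_m is zero for m > M. Letting m run up to M + r pads the recurrence with zeros
    at its low end; with m = N - j the order N - m0 is at least \<open>r\<close>.\<close>
  define N where "N = M + r"
  show ?thesis
  proof (rule that[of "N - m0" "\<lambda>j. Q (N - j) \<circ>\<^sub>p [:of_nat j, 1:]"])
    show "r \<le> N - m0" using \<open>m0 \<le> M\<close> by (simp add: N_def)
    have "N - (N - m0) = m0" using \<open>m0 \<le> M\<close> by (simp add: N_def)
    then show "Q (N - (N - m0)) \<circ>\<^sub>p [:of_nat (N - m0), 1:] \<noteq> 0"
      using m0 by (simp add: pcompose_eq_0_iff)
    fix n
    let ?f = "\<lambda>m. poly (Q m) (of_nat (n + N - m)) * h (n + N - m)"
    have "(\<Sum>j\<le>N - m0. poly (Q (N - j) \<circ>\<^sub>p [:of_nat j, 1:]) (of_nat n) * h (n + j)) =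
          (\<Sum>m\<in>{m0..N}. ?f m)"
      by (rule sum.reindex_bij_witness[of _ "\<lambda>m. N - m" "\<lambda>j. N - j"])
         (use \<open>m0 \<le> M\<close> in \<open>auto simp: poly_pcompose N_def add_ac\<close>)
    also have "\<dots> = (\<Sum>m\<le>n + N. ?f m)"
    proof (rule sum.mono_neutral_left)
      show "\<forall>m\<in>{..n + N} - {m0..N}. ?f m = 0"
        by (force simp: N_def not_le below above)
    qed auto
    also have "\<dots> = 0" by (rule rec)
    finally show "(\<Sum>j\<le>N - m0. poly (Q (N - j) \<circ>\<^sub>p [:of_nat j, 1:]) (of_nat n) * h (n + j)) = 0" .
  qed
qed

section \<open>Factors of the Thue-Morse word and polynomial bounds\<close>

lemma binary_ones_double: "binary_ones (2 * n) = binary_ones n"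
proof -
  have "{k. bit (2 * n) k} = Suc ` {k. bit n k}"
  proof (rule Set.set_eqI)
    show "k \<in> {k. bit (2 * n) k} \<longleftrightarrow> k \<in> Suc ` {k. bit n k}" for k
      by (cases k) (auto simp: bit_Suc bit_0)
  qed
  then show ?thesis by (simp add: binary_ones_def card_image)
qed

lemma binary_ones_Suc_double: "binary_ones (Suc (2 * n)) = Suc (binary_ones n)"
proof -
  have "{k. bit (Suc (2 * n)) k} = insert 0 (Suc ` {k. bit n k})"
  proof (rule Set.set_eqI)
    show "k \<in> {k. bit (Suc (2 * n)) k} \<longleftrightarrow> k \<in> insert 0 (Suc ` {k. bit n k})" for k
      by (cases k) (auto simp: bit_Suc bit_0)
  qed
  then show ?thesis by (simp add: binary_ones_def card_image finite_bits_nat)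
qed

lemma thue_morse_0: "thue_morse 0 = 1"
  by (simp add: thue_morse_def binary_ones_def)

lemma thue_morse_double: "thue_morse (2 * n) = thue_morse n"
  by (simp add: thue_morse_def binary_ones_double)

lemma thue_morse_Suc_double: "thue_morse (Suc (2 * n)) = - thue_morse n"
  by (simp add: thue_morse_def binary_ones_Suc_double)

lemma thue_morse_cases: "thue_morse n = 1 \<or> thue_morse n = -1"
  by (simp add: thue_morse_def minus_one_power_iff)

lemma thue_morse_1: "thue_morse (Suc 0) = -1"
  using thue_morse_Suc_double[of 0] by (simp add: thue_morse_0)

lemma thue_morse_small: "thue_morse 2 = -1" "thue_morse 3 = 1" "thue_morse 5 = 1" "thue_morse 6 = 1"
  using thue_morse_double[of 1] thue_morse_Suc_double[of 1] thue_morse_Suc_double[of 2]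
    thue_morse_double[of 3]
  by (simp_all add: thue_morse_1 eval_nat_numeral)

text \<open>The digits of i fit below those of m, so the digit sums add. The induction peels off the
  lowest digit of i.\<close>

lemma thue_morse_block:
  "i < 2 ^ k \<Longrightarrow> thue_morse (m * 2 ^ k + i) = thue_morse m * thue_morse i"
proof (induction k arbitrary: i)
  case (Suc k)
  obtain j where j: "i = 2 * j \<or> i = Suc (2 * j)"
    by (metis evenE oddE Suc_eq_plus1)
  with Suc.prems have "j < 2 ^ k" by auto
  then have IH: "thue_morse (m * 2 ^ k + j) = thue_morse m * thue_morse j" by (rule Suc.IH)
  from j show ?case
  proof
    assume "i = 2 * j"
    then have "m * 2 ^ Suc k + i = 2 * (m * 2 ^ k + j)" by simp
    then show ?thesis using IH \<open>i = 2 * j\<close> by (simp only: thue_morse_double)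
  next
    assume i: "i = Suc (2 * j)"
    then have "m * 2 ^ Suc k + i = Suc (2 * (m * 2 ^ k + j))" by simp
    then show ?thesis using IH i by (simp only: thue_morse_Suc_double)
  qed
qed (simp add: thue_morse_0)

lemma coprime_hseq: "coprime (hseq n) (hseq (Suc n))"
proof (induction n)
  case (Suc n)
  have "gcd (hseq (Suc n)) (hseq n + thue_morse (Suc (Suc n)) * hseq (Suc n)) =
        gcd (hseq (Suc n)) (hseq n)"
    by (metis gcd_add_mult add.commute)
  with Suc show ?case
    by (simp add: coprime_iff_gcd_eq_1 gcd.commute add.commute)
qed simp

text \<open>The values \<open>x\<close>, \<open>y\<close> continued by the recurrence of \<open>hseq\<close> with the signs \<open>w 2, w 3, \<dots>\<close>; the
  values \<open>w 0\<close> and \<open>w 1\<close> play no role.\<close>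

fun word_rec :: "(nat \<Rightarrow> int) \<Rightarrow> int \<Rightarrow> int \<Rightarrow> nat \<Rightarrow> int" where
  "word_rec w x y 0 = x"
| "word_rec w x y (Suc 0) = y"
| "word_rec w x y (Suc (Suc j)) = w (Suc (Suc j)) * word_rec w x y (Suc j) + word_rec w x y j"

lemma hseq_word_rec:
  "hseq (n + j) = word_rec (\<lambda>i. thue_morse (n + i)) (hseq n) (hseq (Suc n)) j"
  by (induction "\<lambda>i. thue_morse (n + i)" "hseq n" "hseq (Suc n)" j rule: word_rec.induct) simp_all

lemma word_rec_linear: "word_rec w x y j = x * word_rec w 1 0 j + y * word_rec w 0 1 j"
  by (induction w x y j rule: word_rec.induct) (simp_all add: algebra_simps)

lemma word_rec_cong:
  assumes "\<And>i. i \<le> j \<Longrightarrow> w i = w' i"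
  shows "word_rec w x y j = word_rec w' x y j"
  using assms by (induction w x y j rule: word_rec.induct) simp_all

text \<open>This Casoratian of the two basic solutions changes sign at each step whatever the signs
  in \<open>w\<close> are, so the two solutions never vanish at the same index.\<close>

lemma word_rec_det:
  "word_rec w 1 0 j * word_rec w 0 1 (Suc j) - word_rec w 1 0 (Suc j) * word_rec w 0 1 j = (-1) ^ j"
  by (induction j) (simp_all add: algebra_simps)

text \<open>If the signs following position \<open>n\<close> are given by \<open>w\<close>, then a recurrence
  \<open>\<Sum>j\<le>J. p j n * hseq (n + j) = 0\<close> becomes \<open>a n * hseq n + b n * hseq (Suc n) = 0\<close> with
  \<open>a = word_poly p J w 1 0\<close> and \<open>b = word_poly p J w 0 1\<close>.\<close>

definition word_poly :: "(nat \<Rightarrow> rat poly) \<Rightarrow> nat \<Rightarrow> (nat \<Rightarrow> int) \<Rightarrow> int \<Rightarrow> int \<Rightarrow> rat poly" where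
  "word_poly p J w x y = (\<Sum>j\<le>J. smult (of_int (word_rec w x y j)) (p j))"

lemma word_poly_diff:
  assumes "\<And>i. i \<le> j \<Longrightarrow> w i = w' i"
  shows "word_poly p (Suc j) w x y - word_poly p (Suc j) w' x y =
           smult (of_int (word_rec w x y (Suc j) - word_rec w' x y (Suc j))) (p (Suc j))"
proof -
  have "word_rec w x y i = word_rec w' x y i" if "i \<le> j" for i
    using assms that by (intro word_rec_cong) auto
  then show ?thesis by (simp add: word_poly_def smult_diff_left)
qed

text \<open>If both words gave trivial relations, subtracting them would leave only the top term,
  and both basic solutions would vanish at index j + 1, against \<open>word_rec_det\<close>.\<close>

lemma word_poly_special:
  assumes w: "\<And>i. i \<le> Suc j \<Longrightarrow> w i = w' i" and neq: "w (Suc (Suc j)) \<noteq> w' (Suc (Suc j))"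
    and p: "p (Suc (Suc j)) \<noteq> 0"
  shows "\<exists>v\<in>{w, w'}. word_poly p (Suc (Suc j)) v 1 0 \<noteq> 0 \<or> word_poly p (Suc (Suc j)) v 0 1 \<noteq> 0"
proof (rule ccontr)
  assume contr: "\<not> ?thesis"
  have "word_rec w x y (Suc j) = 0" if xy: "(x, y) = (1, 0) \<or> (x, y) = (0, 1)" for x y
  proof -
    have "word_poly p (Suc (Suc j)) w x y - word_poly p (Suc (Suc j)) w' x y = 0"
      using contr xy by auto
    then have "word_rec w x y (Suc (Suc j)) - word_rec w' x y (Suc (Suc j)) = 0"
      using word_poly_diff[of "Suc j" w w' p x y] w p
      by (metis of_int_eq_0_iff smult_eq_0_iff)
    moreover have "word_rec w x y j = word_rec w' x y j"
        "word_rec w x y (Suc j) = word_rec w' x y (Suc j)"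
      using w by (auto intro!: word_rec_cong)
    ultimately show ?thesis using neq by simp
  qed
  then show False using word_rec_det[of w "Suc j"] by simp
qed

text \<open>The words of length \<open>J\<close> ending just before \<open>2 ^ J\<close> and before \<open>6 * 2 ^ J\<close> coincide but are
  followed by different signs, because \<open>t\<^sub>0 = t\<^sub>5\<close> and \<open>t\<^sub>1 \<noteq> t\<^sub>6\<close>.\<close>

lemma thue_morse_special_word:
  assumes p: "p J \<noteq> 0" and J: "J \<ge> 2"
  obtains n where "word_poly p J (\<lambda>i. thue_morse (n + i)) 1 0 \<noteq> 0 \<or>
                   word_poly p J (\<lambda>i. thue_morse (n + i)) 0 1 \<noteq> 0"
proof -
  obtain j where j: "J = Suc (Suc j)" using J by (metis add_2_eq_Suc le_Suc_ex)
  have le: "J \<le> 2 ^ J" by (simp add: less_imp_le)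
  define a where "a = (2::nat) ^ J - J"
  have a: "a + J = 2 ^ J" using le by (simp add: a_def)
  let ?w = "\<lambda>m i. thue_morse ((m * 2 ^ J + a) + i)"
  have low: "?w m i = thue_morse m * thue_morse (a + i)" if "i < J" for m i
    using thue_morse_block[of "a + i" J m] that a by (simp add: add.assoc)
  have top: "?w m J = thue_morse (Suc m)" for m
  proof -
    have "m * 2 ^ J + a + J = Suc m * 2 ^ J + 0" using a by simp
    then show ?thesis using thue_morse_block[of 0 J "Suc m"] by (simp only: thue_morse_0) simp
  qed
  have eq: "?w 0 i = ?w 5 i" if "i \<le> Suc j" for i
    using low[of i 0] low[of i 5] that by (simp only: j thue_morse_0 thue_morse_small)
  have neq: "?w 0 J \<noteq> ?w 5 J"
    using top[of 0] top[of 5] by (simp add: thue_morse_1 thue_morse_small)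
  have "\<exists>v\<in>{?w 0, ?w 5}. word_poly p J v 1 0 \<noteq> 0 \<or> word_poly p J v 0 1 \<noteq> 0"
    by (rule word_poly_special[of j "?w 0" "?w 5" p, folded j, OF eq neq p])
  then show ?thesis using that by blast
qed

text \<open>The word at \<open>n0\<close> lies inside the initial block of length 2^k, and that
  block reappears at every aligned position m 2^k with t_m = 1.\<close>

lemma thue_morse_recurrent:
  assumes "J + n0 < 2 ^ k" and N: "4 * 2 ^ k \<le> N"
  obtains n where "n \<le> N" "N \<le> n + 4 * 2 ^ k"
    "\<And>i. i \<le> J \<Longrightarrow> thue_morse (n + i) = thue_morse (n0 + i)"
proof -
  let ?W = "2 ^ k :: nat"
  \<comment> \<open>Blocks 2r and 2r + 1 form the last aligned pair that ends at or before
    \<open>N\<close>.\<close>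
  define r where "r = N div (2 * ?W) - 1"
  have "N div (2 * ?W) \<ge> 2"
    using N by (simp add: div_nat_eqI less_eq_div_iff_mult_less_eq)
  then have r: "N div (2 * ?W) = r + 1" by (simp add: r_def)
  have r1: "(r + 1) * (2 * ?W) \<le> N" and r2: "N < (r + 2) * (2 * ?W)"
    using div_times_less_eq_dividend[of N "2 * ?W"] dividend_less_div_times[of "2 * ?W" N]
    by (simp_all only: r) (simp_all add: algebra_simps)
  \<comment> \<open>The signs of 2r and 2r + 1 are opposite, so one of them is 1.\<close>
  obtain m where m: "thue_morse m = 1" "2 * r \<le> m" "m \<le> 2 * r + 1"
    using thue_morse_cases[of "2 * r"] thue_morse_Suc_double[of r] thue_morse_double[of r]
    by (metis Suc_eq_plus1 add.inverse_inverse le_add1 order_refl)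
  have m1: "2 * (r * ?W) \<le> m * ?W" and m2: "m * ?W \<le> 2 * (r * ?W) + ?W"
    using mult_le_mono1[OF m(2), of ?W] mult_le_mono1[OF m(3), of ?W]
    by (simp_all only: add_mult_distrib mult.assoc mult_1)
  show ?thesis
  proof (rule that[of "m * ?W + n0"])
    show "m * ?W + n0 \<le> N" using m2 r1 assms(1) unfolding add_mult_distrib by linarith
    show "N \<le> m * ?W + n0 + 4 * 2 ^ k" using m1 r2 unfolding add_mult_distrib by linarith
    show "thue_morse (m * ?W + n0 + i) = thue_morse (n0 + i)" if "i \<le> J" for i
      using thue_morse_block[of "n0 + i" k m] that assms m by (simp add: add.assoc)
  qed
qed

text \<open>Each step at most doubles a common bound on two neighbours; this carries bounds across
  the gaps between occurrences.\<close>

lemma hseq_growth: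
  assumes "\<bar>hseq n\<bar> \<le> M" "\<bar>hseq (Suc n)\<bar> \<le> M"
  shows "\<bar>hseq (n + g)\<bar> \<le> 2 ^ g * M"
proof -
  have "\<bar>hseq (n + g)\<bar> \<le> 2 ^ g * M \<and> \<bar>hseq (Suc (n + g))\<bar> \<le> 2 ^ g * M" for g
  proof (induction g)
    case (Suc g)
    have "\<bar>hseq (Suc (Suc (n + g)))\<bar> \<le> \<bar>hseq (Suc (n + g))\<bar> + \<bar>hseq (n + g)\<bar>"
      using thue_morse_cases[of "Suc (Suc (n + g))"] by auto
    moreover have "0 \<le> 2 ^ g * M" using Suc by linarith
    ultimately show ?case using Suc by (simp add: algebra_simps)
  qed (use assms in simp)
  then show ?thesis by blast
qed

section \<open>Values of rational polynomials: denominators, size, zeros\<close>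

lemma rat_poly_denominator:
  fixes p :: "rat poly"
  obtains D :: int where "D > 0" "\<And>n :: nat. of_int D * poly p (of_nat n) \<in> \<int>"
proof -
  have "\<exists>D :: int. D > 0 \<and> (\<forall>n :: nat. of_int D * poly p (of_nat n) \<in> \<int>)"
  proof (induction p)
    case 0
    show ?case by (intro exI[of _ 1]) auto
  next
    case (pCons a p)
    then obtain D where D: "D > 0" "\<And>n :: nat. of_int D * poly p (of_nat n) \<in> \<int>" by blast
    obtain u v where uv: "a = of_int u / of_int v" "v > 0"
      by (metis Rat_cases Fract_of_int_quotient)
    have "of_int (v * D) * poly (pCons a p) (of_nat n) \<in> \<int>" for n :: nat
    proof -
      have "of_int (v * D) * poly (pCons a p) (of_nat n) =
            of_int (u * D) + of_int (v * int n) * (of_int D * poly p (of_nat n))"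
        using uv by (simp add: field_simps)
      then show ?thesis using D by (simp only: Ints_add Ints_mult Ints_of_int)
    qed
    then show ?case using D uv by (intro exI[of _ "v * D"]) simp
  qed
  then show ?thesis using that by blast
qed

lemma rat_poly_nat_bound:
  fixes p :: "rat poly"
  obtains C d :: nat where "\<And>n :: nat. \<bar>poly p (of_nat n)\<bar> \<le> of_nat (C * Suc n ^ d)"
proof -
  have "\<exists>C d :: nat. \<forall>n :: nat. \<bar>poly p (of_nat n)\<bar> \<le> of_nat (C * Suc n ^ d)"
  proof (induction p)
    case 0
    show ?case by simp
  next
    case (pCons a p)
    then obtain C d where C: "\<And>n. \<bar>poly p (of_nat n)\<bar> \<le> of_nat (C * Suc n ^ d)" by blast
    define A where "A = nat \<lceil>\<bar>a\<bar>\<rceil>"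
    have A: "\<bar>a\<bar> \<le> of_nat A" by (simp add: A_def of_nat_ceiling)
    have "\<bar>poly (pCons a p) (of_nat n)\<bar> \<le> of_nat ((A + C) * Suc n ^ Suc d)" for n
    proof -
      have "\<bar>poly (pCons a p) (of_nat n)\<bar> \<le> \<bar>a\<bar> + of_nat n * \<bar>poly p (of_nat n)\<bar>"
        using abs_triangle_ineq[of a "of_nat n * poly p (of_nat n)"] by (simp add: abs_mult)
      also have "\<dots> \<le> of_nat A + of_nat n * of_nat (C * Suc n ^ d)"
        by (intro add_mono A mult_left_mono C) simp
      also have "\<dots> = of_nat (A * 1 + n * (C * Suc n ^ d))" by simp
      also have "A * 1 + n * (C * Suc n ^ d) \<le> A * Suc n ^ Suc d + Suc n * (C * Suc n ^ d)"
        by (intro add_mono mult_mono) (use one_le_power[of "Suc n" "Suc d"] in auto)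
      also have "\<dots> = (A + C) * Suc n ^ Suc d" by (simp add: algebra_simps)
      finally show ?thesis by simp
    qed
    then show ?case by blast
  qed
  then show ?thesis using that by blast
qed

lemma rat_poly_eventually_nonzero:
  fixes p :: "rat poly"
  assumes "p \<noteq> 0"
  obtains n0 :: nat where "\<And>n. n \<ge> n0 \<Longrightarrow> poly p (of_nat n) \<noteq> 0"
proof -
  have "finite ((of_nat :: nat \<Rightarrow> rat) -` {x. poly p x = 0})"
    by (intro finite_vimageI poly_roots_finite assms inj_of_nat)
  then obtain m where "\<forall>n\<in>(of_nat :: nat \<Rightarrow> rat) -` {x. poly p x = 0}. n < m"
    using finite_nat_set_iff_bounded by blast
  then show ?thesis by (intro that[of m]) force
qed

text \<open>Clearing denominators gives A x + B y = 0 in integers, so x divides B by coprimality. If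
  B = 0, then A is nonzero and x = 0.\<close>

lemma coprime_relation_bound:
  fixes x y :: int and a b :: rat
  assumes "coprime x y" and rel: "a * of_int x + b * of_int y = 0" and nz: "a \<noteq> 0 \<or> b \<noteq> 0"
    and D: "D > 0" "of_int D * a \<in> \<int>" "of_int D * b \<in> \<int>"
  shows "of_int \<bar>x\<bar> \<le> of_int D * \<bar>b\<bar>"
proof -
  obtain A B where AB: "of_int D * a = of_int A" "of_int D * b = of_int B"
    using D by (auto elim!: Ints_cases)
  have "of_int (A * x + B * y) = of_int D * (a * of_int x + b * of_int y)"
    by (simp add: algebra_simps flip: AB)
  then have eq: "A * x + B * y = 0" using rel by (metis mult_zero_right of_int_eq_0_iff)
  then have "x dvd B * y" by (metis dvd_triv_right dvd_0_right dvd_add_right_iff)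
  then have dvd: "x dvd B" using assms(1) by (simp add: coprime_dvd_mult_left_iff)
  have "\<bar>x\<bar> \<le> \<bar>B\<bar>"
  proof (cases "B = 0")
    case True
    then have "A \<noteq> 0" using nz D AB by auto
    with eq True show ?thesis by simp
  next
    case False
    with dvd show ?thesis by (simp add: dvd_imp_le_int)
  qed
  then have "of_int \<bar>x\<bar> \<le> (of_int \<bar>B\<bar> :: rat)" by (simp only: of_int_le_iff)
  also have "\<dots> = \<bar>of_int D * b\<bar>" by (simp add: AB)
  finally show ?thesis using D by (simp add: abs_mult)
qed

theorem P_recursive_hseq_bound:
  fixes p :: "nat \<Rightarrow> rat poly"
  assumes J: "J \<ge> 2" and pJ: "p J \<noteq> 0"
    and rec: "\<And>n. (\<Sum>j\<le>J. poly (p j) (of_nat n) * of_int (hseq (n + j))) = 0"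
  obtains C d n0 :: nat where "\<And>n. n \<ge> n0 \<Longrightarrow> \<bar>hseq n\<bar> \<le> int (C * Suc n ^ d)"
proof -
  obtain n0 where special: "word_poly p J (\<lambda>i. thue_morse (n0 + i)) 1 0 \<noteq> 0 \<or>
                            word_poly p J (\<lambda>i. thue_morse (n0 + i)) 0 1 \<noteq> 0"
    by (rule thue_morse_special_word[of p J, OF pJ J])
  let ?w = "\<lambda>i. thue_morse (n0 + i)"
  define a b where "a = word_poly p J ?w 1 0" and "b = word_poly p J ?w 0 1"
  have rel: "poly a (of_nat n) * of_int (hseq n) + poly b (of_nat n) * of_int (hseq (Suc n)) = 0"
    if occ: "\<And>i. i \<le> J \<Longrightarrow> thue_morse (n + i) = thue_morse (n0 + i)" for n
  proof -
    have h: "hseq (n + j) = hseq n * word_rec ?w 1 0 j + hseq (Suc n) * word_rec ?w 0 1 j"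
      if "j \<le> J" for j
    proof -
      have "hseq (n + j) = word_rec ?w (hseq n) (hseq (Suc n)) j"
        unfolding hseq_word_rec[of n j] using occ that by (intro word_rec_cong) auto
      then show ?thesis using word_rec_linear by metis
    qed
    have "poly a (of_nat n) * of_int (hseq n) + poly b (of_nat n) * of_int (hseq (Suc n)) =
          (\<Sum>j\<le>J. poly (p j) (of_nat n) * of_int (hseq (n + j)))"
      unfolding a_def b_def word_poly_def poly_sum sum_distrib_right sum.distrib[symmetric]
    proof (rule sum.cong)
      fix j assume "j \<in> {..J}"
      then have hj: "(of_int (hseq (n + j)) :: rat) =
          of_int (hseq n) * of_int (word_rec ?w 1 0 j) + of_int (hseq (Suc n)) * of_int (word_rec ?w 0 1 j)"
        by (simp only: h atMost_iff of_int_add of_int_mult)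
      show "poly (smult (of_int (word_rec ?w 1 0 j)) (p j)) (of_nat n) * of_int (hseq n) +
          poly (smult (of_int (word_rec ?w 0 1 j)) (p j)) (of_nat n) * of_int (hseq (Suc n)) =
          poly (p j) (of_nat n) * of_int (hseq (n + j))"
        unfolding hj by (simp add: algebra_simps)
    qed simp
    then show ?thesis using rec by simp
  qed
  obtain n1 where n1: "\<And>n. n \<ge> n1 \<Longrightarrow> poly a (of_nat n) \<noteq> 0 \<or> poly b (of_nat n) \<noteq> 0"
    using rat_poly_eventually_nonzero[of a] rat_poly_eventually_nonzero[of b] special
    unfolding a_def[symmetric] b_def[symmetric] by metis
  obtain Da where Da: "Da > 0" "\<And>n :: nat. of_int Da * poly a (of_nat n) \<in> \<int>"
    using rat_poly_denominator[of a] by blast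
  obtain Db where Db: "Db > 0" "\<And>n :: nat. of_int Db * poly b (of_nat n) \<in> \<int>"
    using rat_poly_denominator[of b] by blast
  \<comment> \<open>One multiplier clears the denominators of both coefficients for all n.\<close>
  define D where "D = Da * Db"
  have D: "D > 0" "of_int D * poly a (of_nat n) \<in> \<int>" "of_int D * poly b (of_nat n) \<in> \<int>" for n :: nat
  proof -
    show "D > 0" using Da Db by (simp add: D_def)
    have "of_int D * poly a (of_nat n) = of_int Db * (of_int Da * poly a (of_nat n))"
         "of_int D * poly b (of_nat n) = of_int Da * (of_int Db * poly b (of_nat n))"
      by (simp_all add: D_def)
    then show "of_int D * poly a (of_nat n) \<in> \<int>" "of_int D * poly b (of_nat n) \<in> \<int>"
      using Da Db by (simp_all only: Ints_mult Ints_of_int)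
  qed
  obtain Ca da where Ca: "\<And>n :: nat. \<bar>poly a (of_nat n)\<bar> \<le> of_nat (Ca * Suc n ^ da)"
    using rat_poly_nat_bound[of a] by blast
  obtain Cb db where Cb: "\<And>n :: nat. \<bar>poly b (of_nat n)\<bar> \<le> of_nat (Cb * Suc n ^ db)"
    using rat_poly_nat_bound[of b] by blast
  define C where "C = nat D * (Ca + Cb)"
  have Cab: "of_int D * \<bar>poly a (of_nat n)\<bar> \<le> of_nat (C * Suc n ^ (da + db))"
            "of_int D * \<bar>poly b (of_nat n)\<bar> \<le> of_nat (C * Suc n ^ (da + db))" for n :: nat
  proof -
    have Dn: "of_int D = (of_nat (nat D) :: rat)" using D(1) by simp
    have "of_int D * \<bar>poly a (of_nat n)\<bar> \<le> of_nat (nat D) * of_nat (Ca * Suc n ^ da)"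
      unfolding Dn by (intro mult_left_mono Ca) simp
    also have "\<dots> = of_nat (nat D * (Ca * Suc n ^ da))" by simp
    also have "nat D * (Ca * Suc n ^ da) \<le> nat D * ((Ca + Cb) * Suc n ^ (da + db))"
      by (intro mult_left_mono mult_mono power_increasing) auto
    finally show "of_int D * \<bar>poly a (of_nat n)\<bar> \<le> of_nat (C * Suc n ^ (da + db))"
      by (simp add: C_def mult.assoc)
    have "of_int D * \<bar>poly b (of_nat n)\<bar> \<le> of_nat (nat D) * of_nat (Cb * Suc n ^ db)"
      unfolding Dn by (intro mult_left_mono Cb) simp
    also have "\<dots> = of_nat (nat D * (Cb * Suc n ^ db))" by simp
    also have "nat D * (Cb * Suc n ^ db) \<le> nat D * ((Ca + Cb) * Suc n ^ (da + db))"
      by (intro mult_left_mono mult_mono power_increasing) auto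
    finally show "of_int D * \<bar>poly b (of_nat n)\<bar> \<le> of_nat (C * Suc n ^ (da + db))"
      by (simp add: C_def mult.assoc)
  qed
  have bound: "\<bar>hseq n\<bar> \<le> int (C * Suc n ^ (da + db))" "\<bar>hseq (Suc n)\<bar> \<le> int (C * Suc n ^ (da + db))"
    if occ: "\<And>i. i \<le> J \<Longrightarrow> thue_morse (n + i) = thue_morse (n0 + i)" and n: "n \<ge> n1" for n
  proof -
    have "of_int \<bar>hseq n\<bar> \<le> of_int D * \<bar>poly b (of_nat n)\<bar>"
      by (rule coprime_relation_bound[OF coprime_hseq rel[OF occ] n1[OF n] D])
    then have "of_int \<bar>hseq n\<bar> \<le> (of_nat (C * Suc n ^ (da + db)) :: rat)"
      using Cab(2)[of n] by (rule order_trans)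
    then have "of_int \<bar>hseq n\<bar> \<le> (of_int (int (C * Suc n ^ (da + db))) :: rat)"
      by (simp only: of_int_of_nat_eq)
    then show "\<bar>hseq n\<bar> \<le> int (C * Suc n ^ (da + db))" by (simp only: of_int_le_iff)
    \<comment> \<open>The same bound with the two terms of the relation exchanged.\<close>
    have "of_int \<bar>hseq (Suc n)\<bar> \<le> of_int D * \<bar>poly a (of_nat n)\<bar>"
      using rel[OF occ] n1[OF n] coprime_hseq[of n]
      by (intro coprime_relation_bound[where x = "hseq (Suc n)" and y = "hseq n"
            and a = "poly b (of_nat n)"] D) (auto simp: coprime_commute add.commute)
    then have "of_int \<bar>hseq (Suc n)\<bar> \<le> (of_nat (C * Suc n ^ (da + db)) :: rat)"
      using Cab(1)[of n] by (rule order_trans)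
    then have "of_int \<bar>hseq (Suc n)\<bar> \<le> (of_int (int (C * Suc n ^ (da + db))) :: rat)"
      by (simp only: of_int_of_nat_eq)
    then show "\<bar>hseq (Suc n)\<bar> \<le> int (C * Suc n ^ (da + db))" by (simp only: of_int_le_iff)
  qed
  \<comment> \<open>Makes the word at \<open>n0\<close> fit into one block of length 2^k.\<close>
  define k where "k = J + n0"
  have k: "J + n0 < 2 ^ k" by (simp add: k_def)
  let ?G = "4 * 2 ^ k :: nat"
  show ?thesis
  \<comment> \<open>An occurrence lies at most \<open>?G\<close> before \<open>N\<close>, and every
    step from there costs a factor 2.\<close>
  proof (rule that[of "n1 + ?G" "2 ^ ?G * C" "da + db"])
    fix N assume N: "n1 + ?G \<le> N"
    then have "?G \<le> N" by simp
    then obtain n where n: "n \<le> N" "N \<le> n + ?G"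
        and occ: "\<And>i. i \<le> J \<Longrightarrow> thue_morse (n + i) = thue_morse (n0 + i)"
      using thue_morse_recurrent[OF k] by metis
    have "n \<ge> n1" using N n by simp
    note b = bound[OF occ this]
    have "\<bar>hseq (n + (N - n))\<bar> \<le> 2 ^ (N - n) * int (C * Suc n ^ (da + db))"
      by (rule hseq_growth[OF b])
    also have "\<dots> \<le> 2 ^ ?G * int (C * Suc N ^ (da + db))"
    proof (rule mult_mono)
      show "(2::int) ^ (N - n) \<le> 2 ^ ?G" using n by (intro power_increasing) auto
      have "C * Suc n ^ (da + db) \<le> C * Suc N ^ (da + db)"
        using n by (intro mult_left_mono power_mono) auto
      then show "int (C * Suc n ^ (da + db)) \<le> int (C * Suc N ^ (da + db))" by (simp only: of_nat_le_iff)
    qed auto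
    finally show "\<bar>hseq N\<bar> \<le> int (2 ^ ?G * C * Suc N ^ (da + db))"
      using n by (simp add: mult.assoc)
  qed
qed

section \<open>Growth\<close>

type_synonym mat2 = "int \<times> int \<times> int \<times> int"

fun mat2_mult :: "mat2 \<Rightarrow> mat2 \<Rightarrow> mat2" where
  "mat2_mult (a, b, c, d) (e, f, g, h) = (a * e + b * g, a * f + b * h, c * e + d * g, c * f + d * h)"

fun mat2_trace :: "mat2 \<Rightarrow> int" where
  "mat2_trace (a, b, c, d) = a + d"

fun mat2_det :: "mat2 \<Rightarrow> int" where
  "mat2_det (a, b, c, d) = a * d - b * c"

fun mat2_apply :: "mat2 \<Rightarrow> int \<times> int \<Rightarrow> int \<times> int" where
  "mat2_apply (a, b, c, d) (x, y) = (a * x + b * y, c * x + d * y)"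

lemma mat2_apply_mult: "mat2_apply (mat2_mult A B) v = mat2_apply A (mat2_apply B v)"
  by (cases A; cases B; cases v) (simp add: algebra_simps)

lemma mat2_det_mult: "mat2_det (mat2_mult A B) = mat2_det A * mat2_det B"
  by (cases A; cases B) (simp add: algebra_simps)

lemma mat2_trace_commute: "mat2_trace (mat2_mult A B) = mat2_trace (mat2_mult B A)"
  by (cases A; cases B) (simp add: algebra_simps)

lemma mat2_cayley_hamilton:
  assumes "mat2_apply A v = v'" "mat2_apply A v' = v''"
  shows "mat2_trace A * fst v' = fst v'' + mat2_det A * fst v"
    "mat2_trace A * snd v' = snd v'' + mat2_det A * snd v"
  using assms by (cases A; cases v; auto simp: algebra_simps)+

text \<open>The trace equals that of A^2 B^2. By Cayley-Hamilton A^2 = tA - 1 and B^2 = tB - 1, and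
  expanding gives t^2 tr(AB) - 2t^2 + 2.\<close>

lemma mat2_trace_ABBA:
  assumes "mat2_det A = 1" "mat2_det B = 1" "mat2_trace A = t" "mat2_trace B = t"
  shows "mat2_trace (mat2_mult (mat2_mult A B) (mat2_mult B A)) =
           t\<^sup>2 * (mat2_trace (mat2_mult B A) - 2) + 2"
proof -
  obtain a b c d where A: "A = (a, b, c, d)" by (cases A)
  obtain e f g h where B: "B = (e, f, g, h)" by (cases B)
  have d: "d = t - a" and h: "h = t - e" using assms by (simp_all add: A B)
  have A2: "a * a + b * c = t * a - 1" "c * b + d * d = t * d - 1"
    and B2: "e * e + f * g = t * e - 1" "g * f + h * h = t * h - 1"
    using assms(1,2) by (simp_all add: A B d h algebra_simps)
  \<comment> \<open>The right-hand side pairs the entries of A^2 with those of B^2.\<close>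
  have "mat2_trace (mat2_mult (mat2_mult A B) (mat2_mult B A)) =
      (a * a + b * c) * (e * e + f * g) + (c * b + d * d) * (g * f + h * h) +
      ((a + d) * b) * ((e + h) * g) + ((a + d) * c) * ((e + h) * f)"
    by (simp add: A B algebra_simps)
  also have "a + d = t" by (simp add: d)
  also have "e + h = t" by (simp add: h)
  finally show ?thesis
    unfolding A2 B2 by (simp add: A B d h algebra_simps power2_eq_square)
qed

text \<open>The transfer matrix of the block of length \<open>2 ^ k\<close> of the Thue-Morse word that
  starts with \<open>s\<close>.\<close>

fun tm_mat :: "nat \<Rightarrow> int \<Rightarrow> mat2" where
  "tm_mat 0 s = (s, 1, 1, 0)"
| "tm_mat (Suc k) s = mat2_mult (tm_mat k (- s)) (tm_mat k s)"

text \<open>The offset 2 appears because t_(n+2) is the first sign applied to the pair (h_(n+1),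
  h_n).\<close>

lemma tm_mat_apply:
  "n + 2 = m * 2 ^ k \<Longrightarrow>
     mat2_apply (tm_mat k (thue_morse m)) (hseq (Suc n), hseq n) =
       (hseq (Suc (n + 2 ^ k)), hseq (n + 2 ^ k))"
proof (induction k arbitrary: n m)
  case 0
  then have "m = Suc (Suc n)" by simp
  then show ?case by simp
next
  case (Suc k)
  have "n + 2 = 2 * m * 2 ^ k" using Suc.prems by simp
  from Suc.IH[OF this]
  have 1: "mat2_apply (tm_mat k (thue_morse m)) (hseq (Suc n), hseq n) =
      (hseq (Suc (n + 2 ^ k)), hseq (n + 2 ^ k))"
    by (simp only: thue_morse_double)
  have "n + 2 ^ k + 2 = Suc (2 * m) * 2 ^ k" using Suc.prems by simp
  from Suc.IH[OF this]
  have "mat2_apply (tm_mat k (- thue_morse m)) (hseq (Suc (n + 2 ^ k)), hseq (n + 2 ^ k)) =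
      (hseq (Suc (n + 2 ^ k + 2 ^ k)), hseq (n + 2 ^ k + 2 ^ k))"
    by (simp only: thue_morse_Suc_double)
  with 1 show ?case
    by (simp add: mat2_apply_mult mult_2 add.assoc)
qed

text \<open>A single letter has determinant -1, so determinant 1 starts with blocks of length
  2.\<close>

lemma tm_mat_det_Suc: "s = 1 \<or> s = -1 \<Longrightarrow> mat2_det (tm_mat (Suc k) s) = 1"
proof (induction k arbitrary: s)
  case (Suc k)
  have "- s = 1 \<or> - s = -1" using Suc.prems by auto
  with Suc show ?case by (simp add: mat2_det_mult del: tm_mat.simps add: tm_mat.simps(2)[of "Suc k"])
qed auto

text \<open>Both matrices are products of the same two factors, in opposite orders.\<close>

lemma tm_mat_trace_uminus: "mat2_trace (tm_mat (Suc k) (- s)) = mat2_trace (tm_mat (Suc k) s)"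
  by (simp add: mat2_trace_commute)

text \<open>Two doublings turn the block A of sign s and its complement B into ABBA, and A and B
  have equal traces.\<close>

lemma tm_mat_trace_rec:
  assumes "s = 1 \<or> s = -1"
  shows "mat2_trace (tm_mat (Suc (Suc (Suc k))) s) =
    (mat2_trace (tm_mat (Suc k) s))\<^sup>2 * (mat2_trace (tm_mat (Suc (Suc k)) s) - 2) + 2"
proof -
  have "- s = 1 \<or> - s = -1" using assms by auto
  then have "mat2_trace (mat2_mult (mat2_mult (tm_mat (Suc k) s) (tm_mat (Suc k) (- s)))
        (mat2_mult (tm_mat (Suc k) (- s)) (tm_mat (Suc k) s))) =
      (mat2_trace (tm_mat (Suc k) s))\<^sup>2 *
        (mat2_trace (mat2_mult (tm_mat (Suc k) (- s)) (tm_mat (Suc k) s)) - 2) + 2"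
    using assms by (intro mat2_trace_ABBA tm_mat_det_Suc tm_mat_trace_uminus refl)
  then show ?thesis
    by (simp only: tm_mat.simps(2)[of "Suc (Suc k)"] tm_mat.simps(2)[of "Suc k"] minus_minus)
qed

lemma tm_mat_trace_ge:
  assumes s: "s = 1 \<or> s = -1"
  shows "mat2_trace (tm_mat (4 + 2 * j) s) \<ge> 9 ^ 2 ^ j"
proof -
  let ?x = "\<lambda>k. mat2_trace (tm_mat k s)"
  have rec: "?x (Suc (Suc (Suc k))) = (?x (Suc k))\<^sup>2 * (?x (Suc (Suc k)) - 2) + 2" for k
    by (rule tm_mat_trace_rec[OF s])
  have "?x (Suc 0) = 1" "?x (Suc (Suc 0)) = 3" using s by auto
  then have x34: "?x 3 = 3" "?x 4 = 11"
    using rec[of 0] rec[of 1] by (simp_all add: eval_nat_numeral del: tm_mat.simps)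
  have x5: "?x 5 = 83" using rec[of 2] x34 by (simp add: eval_nat_numeral del: tm_mat.simps)
  \<comment> \<open>Once x_(k+1) is at least 3, x_(k+2) - 2 is at least x_k^2, so the bound squares
    every two steps from x_4 = 11 on. The odd-indexed bound keeps the factor x_(k+1) - 2
    positive.\<close>
  have "?x (4 + 2 * j) \<ge> 9 ^ 2 ^ j + 2 \<and> ?x (5 + 2 * j) \<ge> 3"
  proof (induction j)
    case 0
    show ?case using x34 x5 by (simp del: tm_mat.simps)
  next
    case (Suc j)
    define z where "z = (9 :: int) ^ 2 ^ j"
    define x4 where "x4 = ?x (4 + 2 * j)"
    define x5 where "x5 = ?x (5 + 2 * j)"
    have z: "z \<ge> 1" by (simp add: z_def)
    have x6: "?x (4 + 2 * Suc j) = x4\<^sup>2 * (x5 - 2) + 2"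
      using rec[of "3 + 2 * j"] unfolding x4_def x5_def by (simp add: eval_nat_numeral del: tm_mat.simps)
    have x7: "?x (5 + 2 * Suc j) = x5\<^sup>2 * (?x (4 + 2 * Suc j) - 2) + 2"
      using rec[of "4 + 2 * j"] unfolding x5_def by (simp add: eval_nat_numeral del: tm_mat.simps)
    have IH: "x4 \<ge> z + 2" "x5 \<ge> 3" using Suc unfolding x4_def x5_def z_def by auto
    have "z\<^sup>2 * 1 \<le> x4\<^sup>2 * (x5 - 2)"
      using IH z by (intro mult_mono power_mono) auto
    then have A: "x4\<^sup>2 * (x5 - 2) \<ge> z\<^sup>2" by simp
    have "z\<^sup>2 \<ge> 1" using z by (simp add: one_le_power)
    then have "1 * 1 \<le> x5\<^sup>2 * (x4\<^sup>2 * (x5 - 2))"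
      using IH A by (intro mult_mono) auto
    moreover have "(9::int) ^ 2 ^ Suc j = z\<^sup>2" by (simp add: z_def power_mult mult.commute flip: power_mult)
    ultimately show ?case using A unfolding x7 x6 by simp
  qed
  then show ?thesis by simp
qed

theorem hseq_not_polynomially_bounded:
  fixes C d n0 :: nat
  shows "\<exists>n\<ge>n0. \<bar>hseq n\<bar> > int (C * Suc n ^ d)"
proof (rule ccontr)
  assume "\<not> ?thesis"
  then have bound: "\<bar>hseq n\<bar> \<le> int (C * Suc n ^ d)" if "n \<ge> n0" for n
    using that by (auto simp: not_less)
  have key: "9 ^ 2 ^ j \<le> int (2 * C * (64 * (2 ^ j)\<^sup>2) ^ d)" if j: "j \<ge> n0" for j
  proof -
    define k where "k = 4 + 2 * j"
    define W where "W = (2::nat) ^ k"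
    have W: "W = 16 * (2 ^ j)\<^sup>2"
      unfolding W_def k_def by (simp add: power_add power_even_eq)
    have "j < 2 ^ j" by simp
    also have "(2::nat) ^ j \<le> (2 ^ j)\<^sup>2" by (simp add: power2_eq_square)
    finally have "j \<le> (2 ^ j)\<^sup>2" by simp
    moreover have "1 \<le> (2 ^ j :: nat)\<^sup>2" by simp
    ultimately have Wge: "W \<ge> n0 + 2" using j unfolding W by linarith
    \<comment> \<open>From here the blocks with indices 1 and 2 follow; they are equal because t_1 =
      t_2 = -1.\<close>
    define n where "n = W - 2"
    have n2: "n + 2 = 1 * 2 ^ k" "n + W + 2 = 2 * 2 ^ k"
      using Wge unfolding n_def W_def by auto
    let ?M = "tm_mat k (-1)"
    have e1: "mat2_apply ?M (hseq (Suc n), hseq n) = (hseq (Suc (n + W)), hseq (n + W))"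
      using tm_mat_apply[OF n2(1)] by (simp add: thue_morse_1 W_def)
    have e2: "mat2_apply ?M (hseq (Suc (n + W)), hseq (n + W)) =
        (hseq (Suc (n + W + W)), hseq (n + W + W))"
      using tm_mat_apply[OF n2(2)] by (simp add: thue_morse_small W_def)
    have det: "mat2_det ?M = 1"
      using tm_mat_det_Suc[of "-1" "3 + 2 * j"] by (simp add: k_def eval_nat_numeral del: tm_mat.simps)
    let ?B = "int (C * (4 * W) ^ d)"
    have B: "\<bar>hseq i\<bar> \<le> ?B" if "n \<le> i" "i \<le> Suc (n + W + W)" for i
    proof -
      have "\<bar>hseq i\<bar> \<le> int (C * Suc i ^ d)"
        by (rule bound) (use that Wge in \<open>auto simp: n_def\<close>)
      also have "C * Suc i ^ d \<le> C * (4 * W) ^ d"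
        by (intro mult_left_mono power_mono) (use that Wge in \<open>auto simp: n_def\<close>)
      finally show ?thesis by simp
    qed
    define T where "T = mat2_trace ?M"
    have T: "9 ^ 2 ^ j \<le> T"
      unfolding T_def k_def by (rule tm_mat_trace_ge) simp
    then have T0: "T \<ge> 0" by (rule order_trans[rotated]) simp
    have CH: "T * hseq (Suc (n + W)) = hseq (Suc (n + W + W)) + hseq (Suc n)"
        "T * hseq (n + W) = hseq (n + W + W) + hseq n"
      using mat2_cayley_hamilton[OF e1 e2] unfolding det T_def by simp_all
    \<comment> \<open>A nonzero integer x has absolute value at least 1. Coprimality provides a
      nonzero coordinate of the middle vector.\<close>
    have le: "T \<le> 2 * ?B" if eq: "T * x = y + z" and "x \<noteq> 0" "\<bar>y\<bar> \<le> ?B" "\<bar>z\<bar> \<le> ?B" for x y z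
    proof -
      have "T * 1 \<le> T * \<bar>x\<bar>" using T0 that by (intro mult_left_mono) auto
      also have "\<dots> = \<bar>y + z\<bar>" using T0 by (simp add: abs_mult flip: eq)
      also have "\<dots> \<le> 2 * ?B" using that by linarith
      finally show ?thesis by simp
    qed
    have "hseq (n + W) \<noteq> 0 \<or> hseq (Suc (n + W)) \<noteq> 0"
      using coprime_hseq[of "n + W"] by auto
    then have "T \<le> 2 * ?B"
    proof
      assume "hseq (n + W) \<noteq> 0"
      from le[OF CH(2) this B B] show ?thesis by simp
    next
      assume "hseq (Suc (n + W)) \<noteq> 0"
      from le[OF CH(1) this B B] show ?thesis by simp
    qed
    with T show ?thesis by (simp add: W mult.assoc)
  qed
  \<comment> \<open>In z = 2^j the inequality \<open>key\<close> compares 9^z with c z^(2d), which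
    fails for large z since exp z is at most 9^z. Using c + 1 below covers the case c = 0.\<close>
  define c where "c = real (2 * C) * 64 ^ d"
  have c: "c \<ge> 0" by (simp add: c_def)
  have "((\<lambda>x :: real. x ^ (2 * d) / exp x) \<longlongrightarrow> 0) at_top"
    by (rule tendsto_power_div_exp_0)
  then have "eventually (\<lambda>x :: real. x ^ (2 * d) / exp x < 1 / (c + 1)) at_top"
    by (rule order_tendstoD) (use c in simp)
  then obtain x0 where x0: "\<And>x. x \<ge> x0 \<Longrightarrow> x ^ (2 * d) / exp x < 1 / (c + 1)"
    by (auto simp: eventually_at_top_linorder)
  define j where "j = max n0 (nat \<lceil>x0\<rceil>)"
  define z where "z = (2::nat) ^ j"
  have "x0 \<le> real j" by (simp add: j_def) linarith
  also have "real j \<le> real z" by (simp add: z_def less_imp_le)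
  finally have "(c + 1) * real z ^ (2 * d) < exp (real z)"
    using x0[of "real z"] c by (simp add: field_simps)
  also have "exp (real z) \<le> 9 ^ z"
    using exp_le power_mono[of "exp 1" "9 :: real" z] by (simp add: exp_of_nat_mult[symmetric])
  finally have "c * real z ^ (2 * d) < 9 ^ z"
    by (rule le_less_trans[rotated]) (simp add: algebra_simps)
  moreover have "c * real z ^ (2 * d) = real (2 * C * (64 * z\<^sup>2) ^ d)"
    by (simp add: c_def power_mult_distrib power_mult)
  moreover have "(9::int) ^ z \<le> int (2 * C * (64 * z\<^sup>2) ^ d)"
    unfolding z_def by (rule key) (simp add: j_def)
  then have "real_of_int (9 ^ z) \<le> real_of_int (int (2 * C * (64 * z\<^sup>2) ^ d))"
    by (simp only: of_int_le_iff)
  ultimately show False by simp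
qed

theorem theorem3:
  shows "ring.transcendental (ring_of_type_algebra :: rat fls ring)
           (rational_functions :: rat fls set) (fps_to_fls Hseries)"
proof (rule ccontr)
  assume "\<not> ?thesis"
  \<comment> \<open>Order at least 2 is requested because \<open>word_rec\<close> reads its signs
    from index 2 on, and the special words must differ in a sign that is read.\<close>
  then obtain J and p :: "nat \<Rightarrow> rat poly" where "J \<ge> 2" "p J \<noteq> 0"
      "\<And>n. (\<Sum>j\<le>J. poly (p j) (of_nat n) * of_int (hseq (n + j))) = 0"
    unfolding Hseries_def by (rule algebraic_imp_P_recursive) blast
  then obtain C d n0 :: nat where "\<And>n. n \<ge> n0 \<Longrightarrow> \<bar>hseq n\<bar> \<le> int (C * Suc n ^ d)"
    by (rule P_recursive_hseq_bound) blast
  then show False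
    using hseq_not_polynomially_bounded[of n0 C d] by (meson not_le)
qed

end
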